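(* Let $B=\{0,1\}^{\{0,1,2,\dots\}}$ with the product topology, let $R:B\to B$ be the one-sided shift $R(x_0,x_1,x_2,\dots)=(x_1,x_2,x_3,\dots)$, and let $F:B\times\{0,1\}\to B\times\{0,1\}$ be given by $F(x,y)=(R(x),x_0)$ for $x=(x_0,x_1,\dots)$. Then there is no Borel function $\phi:B\to\{0,1\}$ whose graph is an attractor of $F$.
   Context: Let $\pi_2(x,y)=y$. In this system, the graph of a function $\phi:B\to\{0,1\}$ is called an attractor if and only if for every $(x,y)\in B\times\{0,1\}$ there is $N$ such that $\pi_2(F^n(x,y))=\phi(R^n(x))$ for every $n\ge N$. *)

theory Defs
  imports "HOL-Analysis.Analysis"
begin

text \<open>
  The alphabet \<open>{0,1}\<close> is \<^typ>\<open>bool\<close> (\<open>0\<close> is \<^term>\<open>False\<close>, \<open>1\<close> is \<^term>\<open>True\<close>), whose library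
  topology is discrete. The library topology on \<^typ>\<open>nat \<Rightarrow> bool\<close> is the product topology
  (\<open>open_fun_def\<close>), so \<^term>\<open>borel\<close> at this type is the Borel sigma-algebra of \<open>B\<close>.
\<close>

type_synonym binary_seq = "nat \<Rightarrow> bool"

definition shift :: "binary_seq \<Rightarrow> binary_seq"
  where "shift x = (\<lambda>n. x (Suc n))"

definition skew_map :: "binary_seq \<times> bool \<Rightarrow> binary_seq \<times> bool"
  where "skew_map = (\<lambda>(x, y). (shift x, x 0))"

text \<open>The graph of \<open>\<phi>\<close> is an attractor of \<^term>\<open>skew_map\<close>; the threshold \<open>N\<close> may depend on the
  starting point \<open>(x, y)\<close>.\<close>

definition graph_attractor :: "(binary_seq \<Rightarrow> bool) \<Rightarrow> bool"
  where "graph_attractor \<phi> \<longleftrightarrow>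
    (\<forall>x y. \<exists>N. \<forall>n\<ge>N. snd ((skew_map ^^ n) (x, y)) = \<phi> ((shift ^^ n) x))"

end

theory Submission
  imports Defs "HOL-Probability.Infinite_Product_Measure" "HOL-Probability.Probability_Mass_Function"
begin

text \<open>
  Along the orbit of \<open>(x, y)\<close> an attracting graph would have to satisfy
  \<open>\<phi> (x\<^sub>n\<^sub>+\<^sub>1, x\<^sub>n\<^sub>+\<^sub>2, \<dots>) = x\<^sub>n\<close> for all large \<open>n\<close>. Let \<open>E\<^sub>N\<close> be the set of all \<open>x\<close> for which this
  holds from \<open>N\<close> on. Flipping the single bit \<open>x\<^sub>N\<close> does not change \<open>(x\<^sub>N\<^sub>+\<^sub>1, x\<^sub>N\<^sub>+\<^sub>2, \<dots>)\<close>, so it maps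
  \<open>E\<^sub>N\<close> into its complement. The flip preserves the fair coin measure, hence \<open>E\<^sub>N\<close> has measure at
  most \<open>1/2\<close>. The sets \<open>E\<^sub>N\<close> increase, so they do not cover \<open>B\<close>.
\<close>

text \<open>A product measure is determined by its values on cylinders over finitely many
  coordinates. A componentwise map pulls such a cylinder back to the cylinder over the preimages of
  its factors, and each factor keeps its measure.\<close>

lemma (in product_prob_space) distr_PiM_componentwise:
  assumes [measurable]: "\<And>i. i \<in> I \<Longrightarrow> f i \<in> measurable (M i) (M i)"
    and f: "\<And>i. i \<in> I \<Longrightarrow> distr (M i) (M i) (f i) = M i"
  shows "distr (PiM I M) (PiM I M) (\<lambda>x. \<lambda>i\<in>I. f i (x i)) = PiM I M"
proof (rule PiM_eq)
  fix J F assume J: "finite J" "J \<subseteq> I" and F: "\<And>j. j \<in> J \<Longrightarrow> F j \<in> sets (M j)"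
  let ?G = "\<lambda>j. f j -` F j \<inter> space (M j)"
  have meas: "(\<lambda>x. \<lambda>i\<in>I. f i (x i)) \<in> measurable (PiM I M) (PiM I M)"
    by measurable
  have "(\<lambda>x. \<lambda>i\<in>I. f i (x i)) -` prod_emb I M J (Pi\<^sub>E J F) \<inter> space (PiM I M)
      = prod_emb I M J (Pi\<^sub>E J ?G)"
  proof (rule set_eqI)
    fix x
    have restr: "restrict (\<lambda>i\<in>I. f i (x i)) J = (\<lambda>j\<in>J. f j (x j))"
      using J(2) by (auto simp: restrict_def fun_eq_iff)
    have "(\<lambda>i\<in>I. f i (x i)) \<in> space (PiM I M)" if "x \<in> space (PiM I M)"
      by (rule measurable_space[OF meas that])
    moreover have "x j \<in> space (M j)" if "x \<in> space (PiM I M)" "j \<in> J" for j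
      using that J(2) by (auto simp: space_PiM)
    ultimately show "x \<in> (\<lambda>x. \<lambda>i\<in>I. f i (x i)) -` prod_emb I M J (Pi\<^sub>E J F) \<inter> space (PiM I M)
        \<longleftrightarrow> x \<in> prod_emb I M J (Pi\<^sub>E J ?G)"
      unfolding prod_emb_def space_PiM[symmetric] vimage_eq Int_iff restr restrict_PiE_iff
      by blast
  qed
  then have "emeasure (distr (PiM I M) (PiM I M) (\<lambda>x. \<lambda>i\<in>I. f i (x i))) (prod_emb I M J (Pi\<^sub>E J F))
      = emeasure (PiM I M) (prod_emb I M J (Pi\<^sub>E J ?G))"
    using J F by (subst emeasure_distr[OF meas]) (auto intro!: sets_PiM_I)
  also have "\<dots> = (\<Prod>j\<in>J. emeasure (M j) (?G j))"
    using J F by (intro emeasure_PiM_emb) (auto intro: measurable_sets assms(1))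
  also have "\<dots> = (\<Prod>j\<in>J. emeasure (M j) (F j))"
  proof (rule prod.cong[OF refl])
    fix j assume "j \<in> J"
    then show "emeasure (M j) (?G j) = emeasure (M j) (F j)"
      using J F emeasure_distr[of "f j" "M j" "M j" "F j"] by (auto simp: f)
  qed
  finally show "emeasure (distr (PiM I M) (PiM I M) (\<lambda>x. \<lambda>i\<in>I. f i (x i)))
      (prod_emb I M J (Pi\<^sub>E J F)) = (\<Prod>j\<in>J. emeasure (M j) (F j))" .
qed simp

definition fair_coins :: "(nat \<Rightarrow> bool) measure"
  where "fair_coins = PiM UNIV (\<lambda>_. measure_pmf (pmf_of_set UNIV))"

definition flip_coin :: "nat \<Rightarrow> (nat \<Rightarrow> bool) \<Rightarrow> nat \<Rightarrow> bool"
  where "flip_coin k x = x(k := \<not> x k)"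

lemma prob_space_fair_coins: "prob_space fair_coins"
  unfolding fair_coins_def by (intro prob_space_PiM prob_space_measure_pmf)

text \<open>Second countability identifies the Borel sets of the product with the product
  sigma-algebra, and makes the set where two Borel maps into \<open>bool\<close> agree
  measurable.\<close>

instance bool :: second_countable_topology
proof
  have "open = generate_topology (UNIV :: bool set set)"
    by (auto simp: fun_eq_iff open_discrete intro: generate_topology.Basis)
  then show "\<exists>B :: bool set set. countable B \<and> open = generate_topology B"
    by (intro exI[of _ UNIV]) auto
qed

text \<open>Links the Borel hypothesis on \<phi> to the coin measure: each factor carries all
  subsets of \<open>bool\<close>, which are its Borel sets because the topology is discrete.\<close>

lemma sets_fair_coins: "sets fair_coins = sets borel"
proof -
  have "sets fair_coins = sets (PiM UNIV (\<lambda>_::nat. borel :: bool measure))"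
    unfolding fair_coins_def
    by (intro sets_PiM_cong) (simp_all add: sets_borel_eq_count_space)
  then show ?thesis
    by (simp only: sets_PiM_equal_borel)
qed

lemma space_fair_coins [simp]: "space fair_coins = UNIV"
  by (simp add: fair_coins_def space_PiM)

lemma distr_flip_coin: "distr fair_coins fair_coins (flip_coin k) = fair_coins"
proof -
  interpret product_prob_space "\<lambda>_. measure_pmf (pmf_of_set (UNIV :: bool set))" "UNIV :: nat set"
    by unfold_locales
  \<comment> \<open>The flip acts componentwise, and every component is a bijection of
    \<open>bool\<close>, hence preserves the uniform distribution.\<close>
  define f where "f = (\<lambda>i. if i = k then Not else id)"
  have "bij (f i)" for i
    by (auto simp: f_def bij_def inj_def surj_def)
  then have "map_pmf (f i) (pmf_of_set UNIV) = pmf_of_set UNIV" for i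
    by (subst map_pmf_of_set_inj) (auto simp: bij_def)
  then have "distr (measure_pmf (pmf_of_set UNIV)) (measure_pmf (pmf_of_set UNIV)) (f i)
      = measure_pmf (pmf_of_set UNIV)" for i
    by (metis distr_cong map_pmf_rep_eq sets_measure_pmf_count_space)
  then have "distr fair_coins fair_coins (\<lambda>x. \<lambda>i\<in>UNIV. f i (x i)) = fair_coins"
    unfolding fair_coins_def by (intro distr_PiM_componentwise) auto
  also have "(\<lambda>x. \<lambda>i\<in>UNIV. f i (x i)) = flip_coin k"
    by (auto simp: f_def flip_coin_def fun_eq_iff)
  finally show ?thesis .
qed

lemma measurable_flip_coin: "flip_coin k \<in> measurable fair_coins fair_coins"
proof -
  have "(\<lambda>x i. flip_coin k x i) \<in> measurable fair_coins fair_coins"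
    unfolding fair_coins_def
  proof (rule measurable_PiM_single')
    fix i
    have "(\<lambda>x. (if i = k then Not else id) (x i))
        \<in> measurable (PiM UNIV (\<lambda>_. measure_pmf (pmf_of_set UNIV)))
            (measure_pmf (pmf_of_set (UNIV :: bool set)))"
      by (rule measurable_compose[OF measurable_component_singleton]) auto
    then show "(\<lambda>x. flip_coin k x i) \<in> measurable (PiM UNIV (\<lambda>_. measure_pmf (pmf_of_set UNIV)))
            (measure_pmf (pmf_of_set UNIV))"
      by (rule measurable_cong[THEN iffD1, rotated]) (simp add: flip_coin_def)
  qed (simp add: space_PiM)
  then show ?thesis by simp
qed

text \<open>The preimage of \<open>A\<close> has the same measure as \<open>A\<close>, and two
  disjoint events of equal probability have total probability at most 1.\<close>

lemma measure_le_half_if_flip_disjoint: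
  assumes A: "A \<in> sets fair_coins" and disj: "flip_coin k -` A \<inter> A = {}"
  shows "measure fair_coins A \<le> 1 / 2"
proof -
  interpret prob_space fair_coins by (rule prob_space_fair_coins)
  have flip: "flip_coin k -` A \<in> events"
    using measurable_sets[OF measurable_flip_coin A] by simp
  have "prob (flip_coin k -` A) = prob A"
    using measure_distr[OF measurable_flip_coin A, of k] by (simp add: distr_flip_coin)
  moreover have "prob (flip_coin k -` A \<union> A) = prob (flip_coin k -` A) + prob A"
    using A flip disj by (intro finite_measure_Union) auto
  ultimately show ?thesis
    using prob_le_1[of "flip_coin k -` A \<union> A"] by simp
qed

lemma shift_funpow: "(shift ^^ n) x = (\<lambda>i. x (i + n))"
  by (induction n) (auto simp: shift_def fun_eq_iff)

text \<open>After one step the initial \<open>y\<close> is forgotten, and the second coordinate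
  always holds the bit just shifted out; time 0 is therefore excluded.\<close>

lemma skew_map_funpow_Suc: "(skew_map ^^ Suc n) (x, y) = ((shift ^^ Suc n) x, x n)"
proof (induction n)
  case (Suc n)
  have "(skew_map ^^ Suc (Suc n)) (x, y) = skew_map ((shift ^^ Suc n) x, x n)"
    by (simp only: funpow.simps(2)[of "Suc n"] comp_apply Suc.IH)
  also have "\<dots> = ((shift ^^ Suc (Suc n)) x, (shift ^^ Suc n) x 0)"
    by (simp add: skew_map_def)
  also have "(shift ^^ Suc n) x 0 = x (Suc n)"
    by (simp only: shift_funpow add_0)
  finally show ?case .
qed (simp add: skew_map_def)

lemma borel_measurable_shift: "shift \<in> borel_measurable borel"
  unfolding shift_def
  by (intro borel_measurable_continuous_onI continuous_on_coordinatewise_then_product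
      continuous_on_product_coordinates)

lemma borel_measurable_shift_funpow: "shift ^^ n \<in> borel_measurable borel"
  by (rule measurable_compose_n[OF borel_measurable_shift])

lemma borel_measurable_coordinate:
  "(\<lambda>x :: 'a \<Rightarrow> 'b::topological_space. x i) \<in> borel_measurable borel"
  by (intro borel_measurable_continuous_onI continuous_on_product_coordinates)

text \<open>These are the sets \<open>E\<^sub>N\<close> of the overview: \<phi> must recover each
  \<open>x n\<close> from the tail strictly after it.\<close>

definition predicted_from :: "(binary_seq \<Rightarrow> bool) \<Rightarrow> nat \<Rightarrow> binary_seq set"
  where "predicted_from \<phi> N = {x. \<forall>n\<ge>N. \<phi> ((shift ^^ Suc n) x) = x n}"

lemma incseq_predicted_from: "incseq (predicted_from \<phi>)"
  by (auto simp: incseq_def predicted_from_def)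

lemma graph_attractor_imp_Union_predicted_from:
  assumes "graph_attractor \<phi>"
  shows "(\<Union>N. predicted_from \<phi> N) = UNIV"
proof -
  have "\<exists>N. x \<in> predicted_from \<phi> N" for x
  proof -
    \<comment> \<open>The value \<open>True\<close> is an arbitrary choice of starting fibre
      point.\<close>
    obtain N where "\<And>n. n \<ge> N \<Longrightarrow> snd ((skew_map ^^ n) (x, True)) = \<phi> ((shift ^^ n) x)"
      using assms unfolding graph_attractor_def by blast
    \<comment> \<open>The attractor condition is applied at time \<open>Suc n\<close>, which still
      exceeds the threshold, so the same \<open>N\<close> serves.\<close>
    then have "\<phi> ((shift ^^ Suc n) x) = x n" if "n \<ge> N" for n
      using that skew_map_funpow_Suc[of n x True] by (metis le_SucI snd_conv)
    then show ?thesis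
      by (auto simp: predicted_from_def)
  qed
  then show ?thesis by auto
qed

lemma sets_predicted_from:
  assumes \<phi>: "\<phi> \<in> borel_measurable borel"
  shows "predicted_from \<phi> N \<in> sets fair_coins"
proof -
  have pred: "(\<lambda>x. \<phi> ((shift ^^ Suc n) x)) \<in> borel_measurable borel" for n
    by (rule measurable_compose[OF borel_measurable_shift_funpow \<phi>])
  \<comment> \<open>A countable intersection of sets where two Borel functions agree.\<close>
  have "{x \<in> space borel. \<forall>n\<in>{N..}. \<phi> ((shift ^^ Suc n) x) = x n} \<in> sets borel"
    by (rule sets.sets_Collect_countable_Ball[OF measurable_equality_set[OF pred
          borel_measurable_coordinate]])
  then show ?thesis
    unfolding predicted_from_def sets_fair_coins space_borel Ball_def atLeast_iff
    by (simp only: UNIV_I simp_thms)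
qed

lemma flip_predicted_from_disjoint: "flip_coin N -` predicted_from \<phi> N \<inter> predicted_from \<phi> N = {}"
proof -
  have False if "x \<in> predicted_from \<phi> N" "flip_coin N x \<in> predicted_from \<phi> N" for x
  proof -
    have "\<phi> ((shift ^^ Suc N) x) = x N" "\<phi> ((shift ^^ Suc N) (flip_coin N x)) = flip_coin N x N"
      using that unfolding predicted_from_def by blast+
    moreover have "(shift ^^ Suc N) (flip_coin N x) = (shift ^^ Suc N) x"
      \<comment> \<open>Only indices \<open>i + Suc N\<close> are read, and none of them is
        \<open>N\<close>.\<close>
      by (simp only: shift_funpow) (simp add: flip_coin_def)
    moreover have "flip_coin N x N \<noteq> x N"
      by (simp add: flip_coin_def)
    ultimately show False
      by (simp only:)
  qed
  then show ?thesis by blast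
qed

theorem corollary3p4:
  shows "\<not> (\<exists>\<phi> :: binary_seq \<Rightarrow> bool. \<phi> \<in> borel_measurable borel \<and> graph_attractor \<phi>)"
proof
  assume "\<exists>\<phi> :: binary_seq \<Rightarrow> bool. \<phi> \<in> borel_measurable borel \<and> graph_attractor \<phi>"
  then obtain \<phi> :: "binary_seq \<Rightarrow> bool"
    where \<phi>: "\<phi> \<in> borel_measurable borel" and attr: "graph_attractor \<phi>"
    by blast
  interpret prob_space fair_coins by (rule prob_space_fair_coins)
  have "(\<lambda>N. prob (predicted_from \<phi> N)) \<longlonglongrightarrow> prob (\<Union>N. predicted_from \<phi> N)"
    using sets_predicted_from[OF \<phi>] incseq_predicted_from
    by (intro finite_Lim_measure_incseq) auto
  moreover have "prob (predicted_from \<phi> N) \<le> 1 / 2" for N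
    by (rule measure_le_half_if_flip_disjoint[OF sets_predicted_from[OF \<phi>]
          flip_predicted_from_disjoint])
  \<comment> \<open>The bound is uniform in \<open>N\<close>, so it survives the limit, whereas the
    union is the whole space and has probability 1.\<close>
  ultimately have "prob (\<Union>N. predicted_from \<phi> N) \<le> 1 / 2"
    by (intro LIMSEQ_le_const2) auto
  then show False
    using prob_space by (simp add: graph_attractor_imp_Union_predicted_from[OF attr])
qed

end
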